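(* Let $(Q,\diamond)$ be a rack. Then there is a one-to-one correspondence between rack-pairing structures on $(Q,\diamond)$ (i.e. binary operations $\star$ on $Q$ such that $(Q,\diamond,\star)$ is a rack-pairing) and regular subracks of the holomorph rack $\mathrm{Hol}(Q,\diamond)$.
   Context: A (left) rack $(Q,\diamond)$ is a nonempty set $Q$ with a binary operation $\diamond$ such that $x\diamond(y\diamond z) = (x\diamond y)\diamond(x\diamond z)$ for all $x,y,z\in Q$, and for any $x,y\in Q$ there is a unique $c\in Q$ with $x\diamond c = y$. A rack-pairing is a triple $(Q,\diamond,\star)$ such that $(Q,\diamond)$ and $(Q,\star)$ are racks and $x\star(y\diamond z) = (x\star y)\diamond(x\star z)$ for all $x,y,z\in Q$. $\mathrm{Aut}(Q,\diamond)$ is the group of rack automorphisms (bijections preserving $\diamond$). The holomorph of $(Q,\diamond)$ is the rack $\mathrm{Hol}(Q,\diamond) := \mathrm{Aut}(Q,\diamond)\times Q$ with operation $(f,x)\,\overline{\diamond}\,(g,y) = (fgf^{-1},f(y))$. A subrack of a rack is a subset closed under the rack operation. Let $\pi_2:\mathrm{Hol}(Q,\diamond)\to Q$ be the projection onto the second factor. A subrack $H\subset\mathrm{Hol}(Q,\diamond)$ is regular if $\pi_2|_H:H\to Q$ is bijective. *)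

theory Defs
  imports "HOL-Algebra.Bij"
begin

locale rack =
  fixes Q :: "'a set" and opr :: "'a \<Rightarrow> 'a \<Rightarrow> 'a"
  assumes nonempty: "Q \<noteq> {}"
    and closed: "\<lbrakk>x \<in> Q; y \<in> Q\<rbrakk> \<Longrightarrow> opr x y \<in> Q"
    and self_distrib:
      "\<lbrakk>x \<in> Q; y \<in> Q; z \<in> Q\<rbrakk> \<Longrightarrow> opr x (opr y z) = opr (opr x y) (opr x z)"
    and left_div: "\<lbrakk>x \<in> Q; y \<in> Q\<rbrakk> \<Longrightarrow> \<exists>!c. c \<in> Q \<and> opr x c = y"

definition rack_pairing ::
    "'a set \<Rightarrow> ('a \<Rightarrow> 'a \<Rightarrow> 'a) \<Rightarrow> ('a \<Rightarrow> 'a \<Rightarrow> 'a) \<Rightarrow> bool" where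
  "rack_pairing Q dia star \<longleftrightarrow>
     rack Q dia \<and> rack Q star \<and>
     (\<forall>x\<in>Q. \<forall>y\<in>Q. \<forall>z\<in>Q. star x (dia y z) = dia (star x y) (star x z))"

text \<open>
  A binary operation on a set \<open>Q\<close> is an element of the extensional function space
  \<open>Q \<rightarrow>\<^sub>E Q \<rightarrow>\<^sub>E Q\<close>, so that equality of HOL functions is
  equality of operations on \<open>Q\<close>.
\<close>

definition rack_pairing_structures ::
    "'a set \<Rightarrow> ('a \<Rightarrow> 'a \<Rightarrow> 'a) \<Rightarrow> ('a \<Rightarrow> 'a \<Rightarrow> 'a) set" where
  "rack_pairing_structures Q dia =
     {star \<in> Q \<rightarrow>\<^sub>E Q \<rightarrow>\<^sub>E Q. rack_pairing Q dia star}"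

definition rack_auto :: "'a set \<Rightarrow> ('a \<Rightarrow> 'a \<Rightarrow> 'a) \<Rightarrow> ('a \<Rightarrow> 'a) set" where
  "rack_auto Q dia = {f \<in> Bij Q. \<forall>x\<in>Q. \<forall>y\<in>Q. f (dia x y) = dia (f x) (f y)}"

definition RackAut :: "'a set \<Rightarrow> ('a \<Rightarrow> 'a \<Rightarrow> 'a) \<Rightarrow> ('a \<Rightarrow> 'a) monoid" where
  "RackAut Q dia = BijGroup Q \<lparr>carrier := rack_auto Q dia\<rparr>"

definition hol_carrier :: "'a set \<Rightarrow> ('a \<Rightarrow> 'a \<Rightarrow> 'a) \<Rightarrow> (('a \<Rightarrow> 'a) \<times> 'a) set" where
  "hol_carrier Q dia = carrier (RackAut Q dia) \<times> Q"

definition hol_op :: "'a set \<Rightarrow> ('a \<Rightarrow> 'a \<Rightarrow> 'a) \<Rightarrow>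
    ('a \<Rightarrow> 'a) \<times> 'a \<Rightarrow> ('a \<Rightarrow> 'a) \<times> 'a \<Rightarrow> ('a \<Rightarrow> 'a) \<times> 'a" where
  "hol_op Q dia = (\<lambda>(f, x) (g, y).
     (f \<otimes>\<^bsub>RackAut Q dia\<^esub> g \<otimes>\<^bsub>RackAut Q dia\<^esub> inv\<^bsub>RackAut Q dia\<^esub> f, f y))"

definition subrack :: "'a set \<Rightarrow> 'a set \<Rightarrow> ('a \<Rightarrow> 'a \<Rightarrow> 'a) \<Rightarrow> bool" where
  "subrack H R opr \<longleftrightarrow> H \<subseteq> R \<and> (\<forall>a\<in>H. \<forall>b\<in>H. opr a b \<in> H)"

definition regular_subracks ::
    "'a set \<Rightarrow> ('a \<Rightarrow> 'a \<Rightarrow> 'a) \<Rightarrow> (('a \<Rightarrow> 'a) \<times> 'a) set set" where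
  "regular_subracks Q dia =
     {H. subrack H (hol_carrier Q dia) (hol_op Q dia) \<and> bij_betw snd H Q}"

end

theory Submission
  imports Defs
begin

text \<open>
  The rows \<open>star x\<close> of a pairing are automorphisms of \<open>(Q, dia)\<close>, and self-distributivity of
  \<open>star\<close> says exactly that conjugating \<open>star y\<close> by \<open>star x\<close> gives \<open>star (star x y)\<close>. So the set
  of pairs \<open>(star x, x)\<close> is closed under the holomorph operation iff \<open>star\<close> is self-distributive,
  and a subset of the holomorph is regular iff it is the graph of a family of automorphisms
  indexed by \<open>Q\<close>.
\<close>

text \<open>This makes \<open>RackAut Q dia\<close> a group, so that the inverse in
  \<open>hol_op\<close> can be cancelled by group laws.\<close>

lemma rack_auto_subgroup:
  assumes "rack Q dia"
  shows "subgroup (rack_auto Q dia) (BijGroup Q)"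
proof -
  interpret rack Q dia by fact
  interpret B: group "BijGroup Q" by (rule group_BijGroup)
  show ?thesis
  proof (rule B.subgroupI)
    show "rack_auto Q dia \<subseteq> carrier (BijGroup Q)"
      by (auto simp: rack_auto_def BijGroup_def)
    have "restrict id Q \<in> rack_auto Q dia"
      by (auto simp: rack_auto_def Bij_def bij_betw_def inj_on_def closed)
    then show "rack_auto Q dia \<noteq> {}" by blast
  next
    fix f assume f: "f \<in> rack_auto Q dia"
    then have fB: "f \<in> Bij Q" and hom: "\<And>x y. \<lbrakk>x \<in> Q; y \<in> Q\<rbrakk> \<Longrightarrow> f (dia x y) = dia (f x) (f y)"
      by (auto simp: rack_auto_def)
    have bij: "bij_betw f Q Q" using fB by (simp add: Bij_def)
    have "inv_into Q f (dia x y) = dia (inv_into Q f x) (inv_into Q f y)"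
      if "x \<in> Q" "y \<in> Q" for x y
    proof -
      let ?g = "inv_into Q f"
      have Q: "?g x \<in> Q" "?g y \<in> Q"
        using that bij_betw_apply[OF bij_betw_inv_into[OF bij]] by auto
      \<comment> \<open>Applying \<open>?g\<close> to this equation and cancelling \<open>f\<close>
        on the left gives the homomorphism law for the inverse.\<close>
      then have "f (dia (?g x) (?g y)) = dia x y"
        using that by (simp add: hom bij_betw_inv_into_right[OF bij])
      then show ?thesis
        using Q closed bij_betw_inv_into_left[OF bij] by metis
    qed
    then show "inv\<^bsub>BijGroup Q\<^esub> f \<in> rack_auto Q dia"
      using fB by (simp add: inv_BijGroup rack_auto_def restrict_inv_into_Bij closed)
  next
    fix f g assume "f \<in> rack_auto Q dia" "g \<in> rack_auto Q dia"
    then show "f \<otimes>\<^bsub>BijGroup Q\<^esub> g \<in> rack_auto Q dia"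
      by (auto simp: rack_auto_def BijGroup_def compose_Bij compose_eq closed Bij_imp_funcset[THEN funcset_mem])
  qed
qed

lemma group_RackAut:
  assumes "rack Q dia"
  shows "group (RackAut Q dia)"
  unfolding RackAut_def
  using rack_auto_subgroup[OF assms] group_BijGroup by (rule subgroup.subgroup_is_group)

lemma carrier_RackAut: "carrier (RackAut Q dia) = rack_auto Q dia"
  by (simp add: RackAut_def)

lemma mult_RackAut:
  assumes "f \<in> rack_auto Q dia" "g \<in> rack_auto Q dia"
  shows "f \<otimes>\<^bsub>RackAut Q dia\<^esub> g = compose Q f g"
  using assms by (auto simp: RackAut_def BijGroup_def rack_auto_def)

text \<open>Multiplying by \<open>f\<close> on the right removes the inverse and leaves an equation
  between two composites. Both are restricted to \<open>Q\<close>, so comparing values on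
  \<open>Q\<close> is enough.\<close>

lemma RackAut_conj_eq_iff:
  assumes "rack Q dia" "f \<in> rack_auto Q dia" "g \<in> rack_auto Q dia" "h \<in> rack_auto Q dia"
  shows "f \<otimes>\<^bsub>RackAut Q dia\<^esub> g \<otimes>\<^bsub>RackAut Q dia\<^esub> inv\<^bsub>RackAut Q dia\<^esub> f = h \<longleftrightarrow>
    (\<forall>z\<in>Q. f (g z) = h (f z))"
proof -
  interpret G: group "RackAut Q dia" by (rule group_RackAut) fact
  note [simp] = carrier_RackAut
  have "f \<otimes>\<^bsub>RackAut Q dia\<^esub> g \<otimes>\<^bsub>RackAut Q dia\<^esub> inv\<^bsub>RackAut Q dia\<^esub> f = h \<longleftrightarrow>
      f \<otimes>\<^bsub>RackAut Q dia\<^esub> g = h \<otimes>\<^bsub>RackAut Q dia\<^esub> f"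
    using assms(2-4) G.inv_solve_right'[of h "f \<otimes>\<^bsub>RackAut Q dia\<^esub> g" f] G.m_closed[of f g] by auto
  also have "\<dots> \<longleftrightarrow> compose Q f g = compose Q h f"
    using assms(2-4) by (simp add: mult_RackAut)
  also have "\<dots> \<longleftrightarrow> (\<forall>z\<in>Q. f (g z) = h (f z))"
    by (auto simp: compose_def restrict_def fun_eq_iff)
  finally show ?thesis .
qed

text \<open>Closure and unique left division of \<open>star\<close> say that each row is a bijection
  of \<open>Q\<close>; compatibility with \<open>dia\<close> makes it an automorphism.
  Extensionality of the rows is part of \<open>Bij\<close>, so only that in the first argument is
  stated separately.\<close>

lemma rack_pairing_structures_iff:
  assumes "rack Q dia"
  shows "star \<in> rack_pairing_structures Q dia \<longleftrightarrow>
    star \<in> extensional Q \<and> (\<forall>x\<in>Q. star x \<in> rack_auto Q dia) \<and>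
    (\<forall>x\<in>Q. \<forall>y\<in>Q. \<forall>z\<in>Q. star x (star y z) = star (star x y) (star x z))"
    (is "?L \<longleftrightarrow> ?R")
proof
  assume L: ?L
  then have S: "star \<in> Q \<rightarrow>\<^sub>E Q \<rightarrow>\<^sub>E Q" and "rack Q star"
    and hom: "\<forall>x\<in>Q. \<forall>y\<in>Q. \<forall>z\<in>Q. star x (dia y z) = dia (star x y) (star x z)"
    by (auto simp: rack_pairing_structures_def rack_pairing_def)
  then interpret rack Q star by simp
  have "bij_betw (star x) Q Q" if "x \<in> Q" for x
    using that left_div[OF that] closed[OF that]
    by (intro bij_betwI') (metis, blast, metis)
  then have "star x \<in> rack_auto Q dia" if "x \<in> Q" for x
    using that S hom by (auto simp: rack_auto_def Bij_def PiE_def)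
  then show ?R using S self_distrib by (auto simp: PiE_def)
next
  assume R: ?R
  have B: "bij_betw (star x) Q Q" "star x \<in> extensional Q" if "x \<in> Q" for x
    using R that by (auto simp: rack_auto_def Bij_def)
  have "rack Q star"
  proof
    show "Q \<noteq> {}" using assms by (rule rack.nonempty)
    show "star x y \<in> Q" if "x \<in> Q" "y \<in> Q" for x y
      using B(1) that by (blast intro: bij_betw_apply)
    show "\<exists>!c. c \<in> Q \<and> star x c = y" if "x \<in> Q" "y \<in> Q" for x y
    proof -
      have inj: "inj_on (star x) Q" and "y \<in> star x ` Q"
        using B(1)[OF that(1)] that(2) by (simp_all add: bij_betw_def)
      then obtain c where "c \<in> Q" "star x c = y" by blast
      with inj show ?thesis by (intro ex1I[of _ c]) (auto dest: inj_onD)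
    qed
  qed (use R in blast)
  moreover have "star \<in> Q \<rightarrow>\<^sub>E Q \<rightarrow>\<^sub>E Q"
    using R B by (auto simp: PiE_def dest: bij_betw_apply)
  ultimately show ?L
    using assms R by (auto simp: rack_pairing_structures_def rack_pairing_def rack_auto_def)
qed

lemma graph_mem_regular_subracks_iff:
  assumes "rack Q dia"
  shows "{(f x, x) | x. x \<in> Q} \<in> regular_subracks Q dia \<longleftrightarrow>
    (\<forall>x\<in>Q. f x \<in> rack_auto Q dia) \<and>
    (\<forall>x\<in>Q. \<forall>y\<in>Q. \<forall>z\<in>Q. f x (f y z) = f (f x y) (f x z))"
    (is "?H \<in> _ \<longleftrightarrow> _")
proof (cases "\<forall>x\<in>Q. f x \<in> rack_auto Q dia")
  case auto: True
  have cl: "f x y \<in> Q" if "x \<in> Q" "y \<in> Q" for x y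
    using auto that by (auto simp: rack_auto_def Bij_def dest: bij_betw_apply)
  \<comment> \<open>The product has second component \<open>f x y\<close>, and the only element of
    \<open>?H\<close> over that point is \<open>(f (f x y), f x y)\<close>. Membership is thus a
    conjugation equation with \<open>h = f (f x y)\<close>.\<close>
  have *: "hol_op Q dia (f x, x) (f y, y) \<in> ?H \<longleftrightarrow> (\<forall>z\<in>Q. f x (f y z) = f (f x y) (f x z))"
    if "x \<in> Q" "y \<in> Q" for x y
    using that auto cl[OF that] RackAut_conj_eq_iff[OF assms, of "f x" "f y" "f (f x y)"]
    by (auto simp: hol_op_def)
  have "bij_betw snd ?H Q"
    by (auto simp: bij_betw_def inj_on_def image_def)
  moreover have "?H \<subseteq> hol_carrier Q dia"
    using auto by (auto simp: hol_carrier_def carrier_RackAut)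
  ultimately have "?H \<in> regular_subracks Q dia \<longleftrightarrow>
      (\<forall>x\<in>Q. \<forall>y\<in>Q. hol_op Q dia (f x, x) (f y, y) \<in> ?H)"
    unfolding regular_subracks_def subrack_def by blast
  with * auto show ?thesis by simp
next
  \<comment> \<open>Both sides fail: some pair \<open>(f x, x)\<close> lies outside the
    holomorph.\<close>
  case False
  then show ?thesis
    by (auto simp: regular_subracks_def subrack_def hol_carrier_def carrier_RackAut)
qed

text \<open>Take \<open>f\<close> to be the first component of the inverse of the projection.
  Restricting it to \<open>Q\<close> makes it a candidate for a pairing structure.\<close>

lemma bij_betw_snd_imp_graph:
  assumes "bij_betw snd H Q"
  obtains f where "f \<in> extensional Q" "H = {(f x, x) | x. x \<in> Q}"
proof
  let ?f = "restrict (\<lambda>x. fst (inv_into H snd x)) Q"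
  show "H = {(?f x, x) | x. x \<in> Q}"
  proof (intro equalityI subsetI)
    fix p assume "p \<in> H"
    then have "snd p \<in> Q" "inv_into H snd (snd p) = p"
      using assms by (simp_all add: bij_betw_apply bij_betw_inv_into_left)
    then have "p = (?f (snd p), snd p)" by simp
    with \<open>snd p \<in> Q\<close> show "p \<in> {(?f x, x) | x. x \<in> Q}" by blast
  next
    fix p assume "p \<in> {(?f x, x) | x. x \<in> Q}"
    then obtain x where x: "x \<in> Q" "p = (fst (inv_into H snd x), x)" by auto
    have "inv_into H snd x \<in> H" "snd (inv_into H snd x) = x"
      using x(1) assms by (auto intro: bij_betw_apply[OF bij_betw_inv_into] bij_betw_inv_into_right)
    then show "p \<in> H" using x(2) by (metis prod.collapse)
  qed
qed (rule restrict_extensional)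

theorem theorem4p20:
  fixes Q :: "'a set" and dia :: "'a \<Rightarrow> 'a \<Rightarrow> 'a"
  assumes "rack Q dia"
  shows "\<exists>\<Phi>. bij_betw \<Phi> (rack_pairing_structures Q dia) (regular_subracks Q dia) \<and>
           (\<forall>star \<in> rack_pairing_structures Q dia. \<Phi> star = {(star x, x) | x. x \<in> Q})"
proof -
  define \<Phi> where "\<Phi> f = {(f x, x) | x. x \<in> Q}" for f :: "'a \<Rightarrow> 'a \<Rightarrow> 'a"
  \<comment> \<open>The two criteria differ only in the extensionality condition. Hence
    \<open>\<Phi>\<close> maps pairings to regular subracks, and an extensional \<open>f\<close>
    whose graph is a regular subrack is a pairing.\<close>
  note iff = rack_pairing_structures_iff[OF assms]
    graph_mem_regular_subracks_iff[OF assms, folded \<Phi>_def]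
  have "bij_betw \<Phi> (rack_pairing_structures Q dia) (regular_subracks Q dia)"
    unfolding bij_betw_def
  proof (intro conjI equalityI subsetI)
    show "inj_on \<Phi> (rack_pairing_structures Q dia)"
    proof (rule inj_onI)
      fix s t assume "s \<in> rack_pairing_structures Q dia" "t \<in> rack_pairing_structures Q dia"
        and eq: "\<Phi> s = \<Phi> t"
      \<comment> \<open>The graph determines the rows only at points of \<open>Q\<close>;
        extensionality settles the rest.\<close>
      then have "s \<in> extensional Q" "t \<in> extensional Q" by (auto simp: iff)
      moreover have "s x = t x" if "x \<in> Q" for x
        using eq that unfolding \<Phi>_def by blast
      ultimately show "s = t" by (rule extensionalityI)
    qed
  next
    fix H assume H: "H \<in> regular_subracks Q dia"
    then obtain f where "f \<in> extensional Q" "H = \<Phi> f"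
      unfolding \<Phi>_def by (auto simp: regular_subracks_def elim: bij_betw_snd_imp_graph)
    then show "H \<in> \<Phi> ` rack_pairing_structures Q dia"
      using H by (simp add: iff)
  qed (auto simp: iff)
  then show ?thesis by (auto simp: \<Phi>_def)
qed

end
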